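(* For every $k<\omega$, the Heyting algebra $H_k$ has the following properties: (i) $H_k$ is $(k+1)$-generated; (ii) $H_k$ does not contain any infinite $k$-generated subalgebra; (iii) $H_k$ contains only finitely many $k$-generated subalgebras up to isomorphism. Thus in particular $H_k$ is a strictly $(k+1)$-generated Heyting algebra.
   Context: For a poset $(X,\leq)$ and $x\in X$, write $x^\uparrow=\{y\in X\mid x\leq y\}$; for $Y\subseteq X$ write $Y^\downarrow=\{x\in X\mid \exists y\in Y,\ x\leq y\}$ and $Y^c=X\setminus Y$. For $n<\omega$, let $\mathfrak{E}_n=(P_n,\leq,\tau)$ be the following ordered topological space. Its points are $P_n=\{x^l_i\mid l\leq 2^n,\ i<\omega\}\cup\{x_\infty\}$ (with $l$ ranging over the $2^n+1$ values $0,\dots,2^n$). The partial order $\leq$ consists of the reflexive pairs together with exactly: $x^l_{i+1}\leq x^{l'}_i$ for all $i<\omega$ and $l,l'\leq 2^n$ with $l'\neq l+1$; $x^l_{i+t}\leq x^{l'}_i$ for all $l,l'\leq 2^n$, $i<\omega$, $t\geq 2$; and $x_\infty\leq x^l_i$ for all $l\leq 2^n$, $i<\omega$. The topology $\tau$ is generated by the subbasis $\{(x^l_i)^\uparrow\mid l\leq 2^n,i<\omega\}\cup\{((x^l_i)^\uparrow)^c\mid l\leq 2^n,i<\omega\}\cup\{\emptyset,(x_\infty)^\uparrow\}$. The space $\mathfrak{E}_n$ is an Esakia space. $H_k$ denotes the Heyting algebra of clopen upsets of $\mathfrak{E}_k$, with $\wedge=\cap$, $\vee=\cup$, $0=\emptyset$,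 $1=P_k$, and $U\to V=((U\setminus V)^\downarrow)^c$. Subalgebras are substructures in the language $\{\wedge,\vee,\to,0,1\}$, and $\langle G\rangle$ is the smallest subalgebra containing $G$. An algebra $A$ is $k$-generated if there is $G\subseteq A$ with $|G|=k$ and $\langle G\rangle=A$. An infinite algebra $A$ is strongly not $k$-generated if $\langle G\rangle$ is finite for every $G\subseteq A$ with $|G|\leq k$. An infinite algebra $A$ is strictly $k$-generated if it is $k$-generated and strongly not $(k-1)$-generated. *)

theory Defs
  imports "HOL-Analysis.Analysis"
begin

section \<open>Heyting algebras as first-order structures\<close>

record 'a heyting =
  hcarrier :: "'a set"
  hmeet :: "'a \<Rightarrow> 'a \<Rightarrow> 'a"
  hjoin :: "'a \<Rightarrow> 'a \<Rightarrow> 'a"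
  himp :: "'a \<Rightarrow> 'a \<Rightarrow> 'a"
  hzero :: "'a"
  hone :: "'a"

text \<open>Closure under the operations and constants of the language. No Heyting axioms are imposed,
  so this makes sense for every structure of this signature.\<close>

definition subalgebra :: "'a set \<Rightarrow> 'a heyting \<Rightarrow> bool" where
  "subalgebra B A \<longleftrightarrow>
     B \<subseteq> hcarrier A \<and> hzero A \<in> B \<and> hone A \<in> B \<and>
     (\<forall>x\<in>B. \<forall>y\<in>B. hmeet A x y \<in> B \<and> hjoin A x y \<in> B \<and> himp A x y \<in> B)"

text \<open>The underlying order is given by \<open>x \<sqinter> y = x\<close>; the last conjunct is residuation:
  \<open>z \<sqinter> x \<le> y\<close> iff \<open>z \<le> x \<rightarrow> y\<close>.\<close>

definition heyting_algebra :: "'a heyting \<Rightarrow> bool" where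
  "heyting_algebra A \<longleftrightarrow>
     subalgebra (hcarrier A) A \<and>
     (\<forall>x\<in>hcarrier A. \<forall>y\<in>hcarrier A.
        hmeet A x y = hmeet A y x \<and> hjoin A x y = hjoin A y x \<and>
        hmeet A x (hjoin A x y) = x \<and> hjoin A x (hmeet A x y) = x) \<and>
     (\<forall>x\<in>hcarrier A. \<forall>y\<in>hcarrier A. \<forall>z\<in>hcarrier A.
        hmeet A (hmeet A x y) z = hmeet A x (hmeet A y z) \<and>
        hjoin A (hjoin A x y) z = hjoin A x (hjoin A y z)) \<and>
     (\<forall>x\<in>hcarrier A. hmeet A (hzero A) x = hzero A \<and> hmeet A x (hone A) = x) \<and>
     (\<forall>x\<in>hcarrier A. \<forall>y\<in>hcarrier A. \<forall>z\<in>hcarrier A.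
        hmeet A (hmeet A z x) y = hmeet A z x \<longleftrightarrow> hmeet A z (himp A x y) = z)"

definition restrict_algebra :: "'a heyting \<Rightarrow> 'a set \<Rightarrow> 'a heyting" where
  "restrict_algebra A B = A\<lparr>hcarrier := B\<rparr>"

definition generated :: "'a heyting \<Rightarrow> 'a set \<Rightarrow> 'a set" where
  "generated A G = \<Inter>{B. subalgebra B A \<and> G \<subseteq> B}"

definition k_generated :: "'a heyting \<Rightarrow> nat \<Rightarrow> bool" where
  "k_generated A k \<longleftrightarrow>
     (\<exists>G. G \<subseteq> hcarrier A \<and> finite G \<and> card G = k \<and> generated A G = hcarrier A)"

definition strongly_not_k_generated :: "'a heyting \<Rightarrow> nat \<Rightarrow> bool" where
  "strongly_not_k_generated A k \<longleftrightarrow>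
     infinite (hcarrier A) \<and>
     (\<forall>G. G \<subseteq> hcarrier A \<and> finite G \<and> card G \<le> k \<longrightarrow> finite (generated A G))"

text \<open>For \<open>k = 0\<close> no set has at most \<open>k - 1\<close> elements, so the second requirement is void;
  the guard keeps natural-number subtraction from turning it into one about the empty set.\<close>

definition strictly_k_generated :: "'a heyting \<Rightarrow> nat \<Rightarrow> bool" where
  "strictly_k_generated A k \<longleftrightarrow>
     infinite (hcarrier A) \<and> k_generated A k \<and>
     (k > 0 \<longrightarrow> strongly_not_k_generated A (k - 1))"

definition heyting_iso :: "('a \<Rightarrow> 'b) \<Rightarrow> 'a heyting \<Rightarrow> 'b heyting \<Rightarrow> bool" where
  "heyting_iso f A B \<longleftrightarrow>
     bij_betw f (hcarrier A) (hcarrier B) \<and>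
     f (hzero A) = hzero B \<and> f (hone A) = hone B \<and>
     (\<forall>x\<in>hcarrier A. \<forall>y\<in>hcarrier A.
        f (hmeet A x y) = hmeet B (f x) (f y) \<and>
        f (hjoin A x y) = hjoin B (f x) (f y) \<and>
        f (himp A x y) = himp B (f x) (f y))"

definition isomorphic :: "'a heyting \<Rightarrow> 'b heyting \<Rightarrow> bool" where
  "isomorphic A B \<longleftrightarrow> (\<exists>f. heyting_iso f A B)"

definition k_generated_subalgebras :: "'a heyting \<Rightarrow> nat \<Rightarrow> 'a set set" where
  "k_generated_subalgebras A k = {B. subalgebra B A \<and> k_generated (restrict_algebra A B) k}"

definition subalgebra_iso_rel :: "'a heyting \<Rightarrow> ('a set \<times> 'a set) set" where
  "subalgebra_iso_rel A =
     {(B, C). subalgebra B A \<and> subalgebra C A \<and>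
              isomorphic (restrict_algebra A B) (restrict_algebra A C)}"


section \<open>Up-sets and down-sets in a poset given by a carrier and a relation\<close>

definition up :: "'p set \<Rightarrow> ('p \<Rightarrow> 'p \<Rightarrow> bool) \<Rightarrow> 'p \<Rightarrow> 'p set" where
  "up X le x = {y \<in> X. le x y}"

definition down :: "'p set \<Rightarrow> ('p \<Rightarrow> 'p \<Rightarrow> bool) \<Rightarrow> 'p set \<Rightarrow> 'p set" where
  "down X le Y = {x \<in> X. \<exists>y\<in>Y. le x y}"

definition upset :: "'p set \<Rightarrow> ('p \<Rightarrow> 'p \<Rightarrow> bool) \<Rightarrow> 'p set \<Rightarrow> bool" where
  "upset X le U \<longleftrightarrow> U \<subseteq> X \<and> (\<forall>x\<in>U. up X le x \<subseteq> U)"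

definition clopen_upsets :: "'p topology \<Rightarrow> ('p \<Rightarrow> 'p \<Rightarrow> bool) \<Rightarrow> 'p set set" where
  "clopen_upsets T le = {U. openin T U \<and> closedin T U \<and> upset (topspace T) le U}"

definition clopen_upset_algebra ::
    "'p topology \<Rightarrow> ('p \<Rightarrow> 'p \<Rightarrow> bool) \<Rightarrow> 'p set heyting" where
  "clopen_upset_algebra T le =
     \<lparr>hcarrier = clopen_upsets T le,
      hmeet = (\<inter>),
      hjoin = (\<union>),
      himp = (\<lambda>U V. topspace T - down (topspace T) le (U - V)),
      hzero = {},
      hone = topspace T\<rparr>"


section \<open>The ordered spaces and their algebras\<close>

text \<open>\<open>Pt l i\<close> stands for $x^l_i$: first the superscript, then the level (level 0 is the top).\<close>

datatype point = Pt nat nat | Inf_pt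

definition P :: "nat \<Rightarrow> point set" where
  "P n = {Pt l i | l i. l \<le> 2 ^ n} \<union> {Inf_pt}"

definition E_le :: "nat \<Rightarrow> point \<Rightarrow> point \<Rightarrow> bool" where
  "E_le n x y \<longleftrightarrow> x \<in> P n \<and> y \<in> P n \<and>
     (x = y \<or>
      (\<exists>i l l'. x = Pt l (i + 1) \<and> y = Pt l' i \<and> l' \<noteq> l + 1) \<or>
      (\<exists>i l l' t. t \<ge> 2 \<and> x = Pt l (i + t) \<and> y = Pt l' i) \<or>
      (\<exists>i l. x = Inf_pt \<and> y = Pt l i))"

text \<open>The subbasis has \<open>up (P n) (E_le n) Inf_pt = P n\<close> as a member, so the generated
  topology has \<open>P n\<close> as its underlying space.\<close>

definition E_top :: "nat \<Rightarrow> point topology" where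
  "E_top n = topology_generated_by
     ({up (P n) (E_le n) (Pt l i) | l i. l \<le> 2 ^ n} \<union>
      {P n - up (P n) (E_le n) (Pt l i) | l i. l \<le> 2 ^ n} \<union>
      {{}, up (P n) (E_le n) Inf_pt})"

definition H :: "nat \<Rightarrow> point set heyting" where
  "H k = clopen_upset_algebra (E_top k) (E_le k)"

lemma topspace_E_top: "topspace (E_top n) = P n"
proof -
  have "up (P n) (E_le n) Inf_pt = P n"
    by (auto simp: up_def P_def E_le_def)
  moreover have "up (P n) (E_le n) x \<subseteq> P n" for x
    by (auto simp: up_def)
  ultimately show ?thesis
    unfolding E_top_def by (auto simp: topology_generated_by_topspace)
qed

end

theory Submission
  imports Defs
begin

text \<open>
  Write \<open>N = 2 ^ n\<close>, so that each level has \<open>N + 1\<close> points. Apart from the whole space, the clopen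
  upsets are the finite upsets that avoid the limit point (\<open>carrier_H\<close>), so everything is
  combinatorics of a ladder in which a point sees all the levels above it, except that the point
  \<open>l\<close> of a level misses the point \<open>l + 1\<close> of the level immediately above.

  Generation by \<open>n + 1\<close> elements: \<open>n + 1\<close> subsets of level 0 suffice to tell its \<open>2 ^ n + 1\<close> points
  apart. Once a level and everything above it is available, so is the next level: its only point
  missing \<open>l + 1\<close> above is \<open>l\<close>, and the last point \<open>N\<close> is what is left after the others are
  removed (\<open>principals_generated_by_tops\<close>).

  Finiteness for \<open>n\<close> generators: a set \<open>G\<close> of generators colours the points by the generators that
  contain them, and every equivalence relation which respects the colours and the back-and-forth
  condition for the order yields a subalgebra of saturated sets containing \<open>G\<close>
  (\<open>subalgebra_saturated_sets\<close>). Such a relation is obtained by going down the ladder. A point \<open>l\<close> is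
  \<^emph>\<open>blind\<close> at its level if it cannot notice that it misses \<open>l + 1\<close>, because that point has an
  equivalent twin on its level; two blind points of the same level and colour are identified. The
  heart of the proof is that twins exist on every level. A generator varies on at most two
  consecutive levels, and if it varies on both, it does so only by cutting a single point out of the
  upper one; this already separates the one point of the lower level that it contains, so that each
  generator splits blind points on one level only (\<open>color_determined\<close>). With \<open>j\<close> splitting
  generators at most \<open>2 ^ j - 1\<close> blind points lose all their twins, and
  \<open>(2 ^ a - 1) + (2 ^ b - 1) \<le> 2 ^ (a + b) - 1\<close> shows that over all the levels together at most
  \<open>2 ^ n - 1\<close> of the \<open>2 ^ n + 1\<close> points are lost (\<open>card_blind\<close>).

  On levels where no generator varies, every blind point has a twin. The points that are not blind
  then have indices one smaller on each further level, so after \<open>N + 1\<close> such levels all points are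
  blind, and from there on consecutive levels can be identified entirely (\<open>glued_if_far\<close>). Hence the
  number of equivalence classes is bounded, not only for each \<open>G\<close>, but by a number depending on \<open>n\<close>
  alone (\<open>generated_bounded\<close>). As there are only finitely many structures of bounded size up to
  isomorphism, this also gives the finiteness of the number of isomorphism types.
\<close>

section \<open>The ladder and its clopen upsets\<close>

lemma E_le_simps [simp]:
  "E_le n (Pt l i) (Pt l' j) \<longleftrightarrow> l \<le> 2 ^ n \<and> l' \<le> 2 ^ n \<and>
     ((l = l' \<and> i = j) \<or> (i = Suc j \<and> l' \<noteq> Suc l) \<or> Suc (Suc j) \<le> i)"
  "\<not> E_le n (Pt l i) Inf_pt"
  "E_le n Inf_pt y \<longleftrightarrow> y \<in> P n"
  subgoal
  proof -
    have "(\<exists>t\<ge>2. i = j + t) \<longleftrightarrow> Suc (Suc j) \<le> i"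
      by (auto intro: exI[of _ "i - j"])
    then show ?thesis by (auto simp: E_le_def P_def)
  qed
  subgoal by (simp add: E_le_def)
  subgoal by (cases y) (auto simp: E_le_def P_def)
  done

lemma P_simps [simp]: "Pt l i \<in> P n \<longleftrightarrow> l \<le> 2 ^ n" "Inf_pt \<in> P n"
  by (auto simp: P_def)

lemma E_le_refl: "x \<in> P n \<Longrightarrow> E_le n x x"
  by (cases x) auto

lemma E_le_in_P: "E_le n x y \<Longrightarrow> x \<in> P n \<and> y \<in> P n"
  by (simp add: E_le_def)

lemma E_le_trans:
  assumes "E_le n x y" "E_le n y z" shows "E_le n x z"
  using assms by (cases x; cases y; cases z) auto

lemma upset_downD: "upset (P n) (E_le n) U \<Longrightarrow> x \<in> U \<Longrightarrow> E_le n x y \<Longrightarrow> y \<in> U"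
  using E_le_in_P[of n x y] by (auto simp: upset_def up_def)

definition levels_upto :: "nat \<Rightarrow> nat \<Rightarrow> point set" where
  "levels_upto n i = {Pt l j | l j. l \<le> 2 ^ n \<and> j \<le> i}"

lemma mem_levels_upto [simp]:
  "Pt l j \<in> levels_upto n i \<longleftrightarrow> l \<le> 2 ^ n \<and> j \<le> i" "Inf_pt \<notin> levels_upto n i"
  by (auto simp: levels_upto_def)

lemma finite_levels_upto: "finite (levels_upto n i)"
proof -
  have "levels_upto n i = (\<lambda>(l, j). Pt l j) ` ({..2 ^ n} \<times> {..i})"
    by (auto simp: levels_upto_def)
  then show ?thesis by simp
qed

lemma up_Pt_subset: "up (P n) (E_le n) (Pt l i) \<subseteq> levels_upto n i"
proof
  fix x assume "x \<in> up (P n) (E_le n) (Pt l i)"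
  then show "x \<in> levels_upto n i" by (cases x) (auto simp: up_def levels_upto_def)
qed

definition fin_upset :: "nat \<Rightarrow> point set \<Rightarrow> bool" where
  "fin_upset n U \<longleftrightarrow> finite U \<and> Inf_pt \<notin> U \<and> upset (P n) (E_le n) U"

text \<open>The limit point is the only one whose neighbourhoods must be large: each subbasic set
  containing it omits at most one principal upset of a ladder point, and those are finite.\<close>

lemma E_open_cofinite:
  assumes "openin (E_top n) V" "Inf_pt \<in> V" shows "finite (P n - V)"
proof -
  let ?S = "{up (P n) (E_le n) (Pt l i) | l i. l \<le> 2 ^ n} \<union>
      {P n - up (P n) (E_le n) (Pt l i) | l i. l \<le> 2 ^ n} \<union>
      {{}, up (P n) (E_le n) Inf_pt}"
  have "generate_topology_on ?S V"
    using assms(1) by (simp add: E_top_def openin_topology_generated_by_iff)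
  then have "Inf_pt \<in> V \<longrightarrow> finite (P n - V)"
  proof induction
    case (Int a b)
    then show ?case by (simp add: Diff_Int)
  next
    case (UN K)
    show ?case
    proof
      assume "Inf_pt \<in> \<Union>K"
      then obtain k where "k \<in> K" "finite (P n - k)" using UN by auto
      then show "finite (P n - \<Union>K)" by (auto elim: finite_subset[rotated])
    qed
  next
    case (Basis s)
    have "finite (up (P n) (E_le n) (Pt l i))" for l i
      using up_Pt_subset finite_levels_upto by (rule finite_subset)
    moreover have "P n - up (P n) (E_le n) Inf_pt = {}"
      by (auto simp: up_def)
    ultimately show ?case using Basis by (auto simp: up_def Diff_Diff_Int Int_def)
  qed simp
  with assms(2) show ?thesis by simp
qed

lemma clopen_up_Pt:
  assumes "l \<le> 2 ^ n"
  shows "openin (E_top n) (up (P n) (E_le n) (Pt l i))"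
    and "closedin (E_top n) (up (P n) (E_le n) (Pt l i))"
proof -
  show "openin (E_top n) (up (P n) (E_le n) (Pt l i))"
    unfolding E_top_def using assms by (intro topology_generated_by_Basis) blast
  have "openin (E_top n) (P n - up (P n) (E_le n) (Pt l i))"
    unfolding E_top_def using assms by (intro topology_generated_by_Basis) blast
  then show "closedin (E_top n) (up (P n) (E_le n) (Pt l i))"
    by (auto simp: closedin_def topspace_E_top up_def)
qed

lemma fin_upset_eq_Union:
  assumes "fin_upset n U" shows "U = (\<Union>x\<in>U. up (P n) (E_le n) x)"
  using assms by (auto simp: fin_upset_def upset_def up_def intro: E_le_refl)

text \<open>A clopen upset containing the limit point, which is the least element, is everything. If it
  does not contain it, its complement is an open neighbourhood of the limit point, hence
  cofinite. Conversely, a finite upset is a finite union of principal ones, which are clopen.\<close>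

lemma carrier_H: "hcarrier (H n) = insert (P n) {U. fin_upset n U}"
proof (intro equalityI subsetI)
  fix U assume "U \<in> hcarrier (H n)"
  then have U: "openin (E_top n) U" "closedin (E_top n) U" "upset (P n) (E_le n) U"
    by (auto simp: H_def clopen_upset_algebra_def clopen_upsets_def topspace_E_top)
  show "U \<in> insert (P n) {U. fin_upset n U}"
  proof (cases "Inf_pt \<in> U")
    case True
    then have "U = P n" using U(3) by (auto simp: upset_def up_def)
    then show ?thesis by simp
  next
    case False
    have "finite (P n - (P n - U))"
      using U(2) False by (intro E_open_cofinite) (auto simp: closedin_def topspace_E_top)
    moreover have "P n - (P n - U) = U" using U(3) by (auto simp: upset_def)
    ultimately show ?thesis using U False by (simp add: fin_upset_def)
  qed
next
  fix U assume "U \<in> insert (P n) {U. fin_upset n U}"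
  then consider "U = P n" | "fin_upset n U" by auto
  then have "openin (E_top n) U \<and> closedin (E_top n) U \<and> upset (P n) (E_le n) U"
  proof cases
    case 1
    then show ?thesis using openin_topspace[of "E_top n"] closedin_topspace[of "E_top n"]
      by (auto simp: topspace_E_top upset_def up_def)
  next
    case 2
    have U: "openin (E_top n) (up (P n) (E_le n) x)" "closedin (E_top n) (up (P n) (E_le n) x)"
      if "x \<in> U" for x
      using that 2 clopen_up_Pt by (cases x; auto simp: fin_upset_def upset_def)+
    have "openin (E_top n) (\<Union>x\<in>U. up (P n) (E_le n) x)"
      using U(1) by auto
    moreover have "closedin (E_top n) (\<Union>x\<in>U. up (P n) (E_le n) x)"
      using 2 U(2) by (intro closedin_Union) (auto simp: fin_upset_def)
    ultimately show ?thesis using 2 fin_upset_eq_Union[OF 2] by (simp add: fin_upset_def)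
  qed
  then show "U \<in> hcarrier (H n)"
    by (auto simp: H_def clopen_upset_algebra_def clopen_upsets_def topspace_E_top)
qed

lemma H_ops [simp]:
  "hmeet (H n) = (\<inter>)" "hjoin (H n) = (\<union>)"
  "himp (H n) = (\<lambda>U V. P n - down (P n) (E_le n) (U - V))"
  "hzero (H n) = {}" "hone (H n) = P n"
  by (simp_all add: H_def clopen_upset_algebra_def topspace_E_top)

lemma carrier_upset: "U \<in> hcarrier (H n) \<Longrightarrow> upset (P n) (E_le n) U"
  by (auto simp: carrier_H fin_upset_def upset_def up_def)

lemma carrier_subset: "U \<in> hcarrier (H n) \<Longrightarrow> U \<subseteq> P n"
  using carrier_upset by (auto simp: upset_def)

lemma points_infinite: "infinite {Pt l i | l i. l \<le> (2::nat) ^ n}"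
proof -
  have "inj (\<lambda>i. Pt 0 i)" by (auto simp: inj_on_def)
  then have "infinite (range (\<lambda>i. Pt 0 i))" using finite_imageD by blast
  then show ?thesis by (rule infinite_super[rotated]) auto
qed

text \<open>If \<open>U\<close> is not contained in \<open>V\<close>, then some ladder point \<open>Pt l i\<close> lies in \<open>U - V\<close>, also when
  \<open>U\<close> is the whole space, as \<open>V\<close> is then finite. All levels from \<open>i + 2\<close> on are below that
  point, which leaves only finitely many points for the implication.\<close>

lemma himp_closed:
  assumes U: "U \<in> hcarrier (H n)" and V: "V \<in> hcarrier (H n)"
  shows "P n - down (P n) (E_le n) (U - V) \<in> hcarrier (H n)" (is "?I \<in> _")
proof (cases "U \<subseteq> V")
  case True
  then have empty: "U - V = {}" by auto
  show ?thesis unfolding empty by (simp add: down_def carrier_H)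
next
  case False
  have up: "upset (P n) (E_le n) ?I"
    by (auto simp: upset_def up_def down_def intro: E_le_trans)
  obtain l i where li: "Pt l i \<in> U" "Pt l i \<notin> V"
  proof -
    obtain x where x: "x \<in> U" "x \<notin> V" using False by auto
    show ?thesis
    proof (cases x)
      case Inf_pt
      then have "U = P n" and "fin_upset n V" using U V x by (auto simp: carrier_H fin_upset_def)
      then have "\<not> {Pt l i | l i. l \<le> (2::nat) ^ n} \<subseteq> V"
        using points_infinite[of n] finite_subset by (auto simp: fin_upset_def)
      then show ?thesis using \<open>U = P n\<close> that by auto
    qed (use x that in auto)
  qed
  then have l: "l \<le> 2 ^ n" using carrier_subset[OF U] by auto
  have "?I \<subseteq> levels_upto n (i + 1)"
  proof
    fix x assume x: "x \<in> ?I"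
    then have "\<not> E_le n x (Pt l i)" "x \<in> P n" using li l by (auto simp: down_def)
    then show "x \<in> levels_upto n (i + 1)" using l by (cases x) (auto simp: levels_upto_def)
  qed
  then have "finite ?I" "Inf_pt \<notin> ?I"
    using finite_levels_upto[of n "i + 1"] finite_subset mem_levels_upto(2) by blast+
  then show ?thesis using up by (simp add: carrier_H fin_upset_def)
qed

lemma subalgebra_carrier_H: "subalgebra (hcarrier (H n)) (H n)"
  unfolding subalgebra_def
proof (intro conjI ballI)
  show "hzero (H n) \<in> hcarrier (H n)" "hone (H n) \<in> hcarrier (H n)"
    by (auto simp: carrier_H fin_upset_def upset_def)
  fix U V assume UV: "U \<in> hcarrier (H n)" "V \<in> hcarrier (H n)"
  then have sub: "U \<subseteq> P n" "V \<subseteq> P n" by (auto dest: carrier_subset)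
  show "hmeet (H n) U V \<in> hcarrier (H n)"
    using UV sub by (auto simp: carrier_H fin_upset_def upset_def Int_absorb1 Int_absorb2)
  show "hjoin (H n) U V \<in> hcarrier (H n)"
    using UV sub by (auto simp: carrier_H fin_upset_def upset_def Un_absorb1 Un_absorb2)
  show "himp (H n) U V \<in> hcarrier (H n)" using himp_closed[OF UV] by simp
qed simp

lemma heyting_algebra_H: "heyting_algebra (H n)"
  unfolding heyting_algebra_def
proof (intro conjI ballI)
  fix U assume U: "U \<in> hcarrier (H n)"
  show "hmeet (H n) U (hone (H n)) = U" using carrier_subset[OF U] by auto
  fix V assume V: "V \<in> hcarrier (H n)"
  fix W assume W: "W \<in> hcarrier (H n)"
  show "(hmeet (H n) (hmeet (H n) W U) V = hmeet (H n) W U) =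
        (hmeet (H n) W (himp (H n) U V) = W)"
  proof
    assume "hmeet (H n) (hmeet (H n) W U) V = hmeet (H n) W U"
    then have *: "W \<inter> U \<subseteq> V" by auto
    show "hmeet (H n) W (himp (H n) U V) = W"
      using * carrier_subset[OF W] upset_downD[OF carrier_upset[OF W]]
      by (auto simp: down_def)
  next
    assume "hmeet (H n) W (himp (H n) U V) = W"
    then have *: "W \<subseteq> P n - down (P n) (E_le n) (U - V)" by auto
    have "x \<in> V" if "x \<in> W" "x \<in> U" for x
      using that * E_le_refl[of x n] by (auto simp: down_def)
    then show "hmeet (H n) (hmeet (H n) W U) V = hmeet (H n) W U" by auto
  qed
qed (use subalgebra_carrier_H in auto)

lemma infinite_carrier_H: "infinite (hcarrier (H n))"
proof -
  have "inj (levels_upto n)"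
  proof (rule injI)
    fix i j assume eq: "levels_upto n i = levels_upto n j"
    have "Pt 0 a \<in> levels_upto n b \<longleftrightarrow> a \<le> b" for a b by (auto simp: levels_upto_def)
    then show "i = j" using eq by (metis le_antisym order_refl)
  qed
  moreover have "range (levels_upto n) \<subseteq> hcarrier (H n)"
  proof safe
    fix i
    have "upset (P n) (E_le n) (levels_upto n i)"
      unfolding upset_def
    proof (intro conjI subsetI ballI)
      fix x y assume "x \<in> levels_upto n i" "y \<in> up (P n) (E_le n) x"
      then show "y \<in> levels_upto n i" by (cases y) (auto simp: levels_upto_def up_def)
    qed (auto simp: levels_upto_def)
    then show "levels_upto n i \<in> hcarrier (H n)"
      using finite_levels_upto by (auto simp: carrier_H fin_upset_def levels_upto_def)
  qed
  ultimately show ?thesis using infinite_super range_inj_infinite by blast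
qed

section \<open>Generated subalgebras and isomorphism types\<close>

lemma generated_subalgebra:
  assumes "subalgebra (hcarrier A) A" "G \<subseteq> hcarrier A"
  shows "subalgebra (generated A G) A" "G \<subseteq> generated A G"
  using assms by (auto simp: generated_def subalgebra_def)

lemma generated_least: "subalgebra B A \<Longrightarrow> G \<subseteq> B \<Longrightarrow> generated A G \<subseteq> B"
  by (auto simp: generated_def)

text \<open>The subalgebras of a subalgebra \<open>B\<close> are the subalgebras of \<open>A\<close> inside \<open>B\<close>. This turns a
  \<open>k\<close>-generated subalgebra into the subalgebra generated by a set of \<open>k\<close> elements.\<close>

lemma generated_restrict:
  assumes "subalgebra B A" "G \<subseteq> B"
  shows "generated (restrict_algebra A B) G = generated A G"
proof -
  have "subalgebra C (restrict_algebra A B) \<longleftrightarrow> subalgebra C A \<and> C \<subseteq> B" for C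
    using assms by (auto simp: subalgebra_def restrict_algebra_def)
  moreover have "subalgebra (C \<inter> B) A" if "subalgebra C A" for C
    using assms that by (auto simp: subalgebra_def)
  ultimately show ?thesis using assms unfolding generated_def by blast
qed

text \<open>The graph of a binary operation, transported along \<open>h\<close>. As a set of triples of numbers it
  ranges over a finite set once the sizes are bounded.\<close>

definition table :: "('a \<Rightarrow> nat) \<Rightarrow> 'a set \<Rightarrow> ('a \<Rightarrow> 'a \<Rightarrow> 'a) \<Rightarrow> (nat \<times> nat \<times> nat) set" where
  "table h B f = {(h x, h y, h (f x y)) | x y. x \<in> B \<and> y \<in> B}"

lemma table_transfer:
  assumes h: "bij_betw h B I" and g: "bij_betw g C I"
    and B: "\<forall>x\<in>B. \<forall>y\<in>B. f x y \<in> B" and C: "\<forall>x\<in>C. \<forall>y\<in>C. f' x y \<in> C"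
    and eq: "table h B f = table g C f'" and xy: "x \<in> B" "y \<in> B"
  shows "inv_into C g (h (f x y)) = f' (inv_into C g (h x)) (inv_into C g (h y))"
proof -
  have "(h x, h y, h (f x y)) \<in> table h B f" using xy unfolding table_def by blast
  then have "(h x, h y, h (f x y)) \<in> table g C f'" using eq by simp
  then obtain u v where "u \<in> C" "v \<in> C" "h x = g u" "h y = g v" "h (f x y) = g (f' u v)"
    unfolding table_def mem_Collect_eq prod.inject by blast
  then show ?thesis using C g by (simp add: bij_betw_def inv_into_f_f)
qed

lemma isomorphic_sym:
  assumes "isomorphic A B" "subalgebra (hcarrier A) A"
  shows "isomorphic B A"
proof -
  obtain f where f: "heyting_iso f A B" using assms(1) by (auto simp: isomorphic_def)
  let ?g = "inv_into (hcarrier A) f"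
  have bij: "bij_betw f (hcarrier A) (hcarrier B)" using f by (simp add: heyting_iso_def)
  have inj: "inj_on f (hcarrier A)" using bij by (simp add: bij_betw_def)
  have gf: "?g (f x) = x" if "x \<in> hcarrier A" for x using inj that by (rule inv_into_f_f)
  have "heyting_iso ?g B A"
    unfolding heyting_iso_def
  proof (intro conjI ballI)
    show "bij_betw ?g (hcarrier B) (hcarrier A)" using bij by (rule bij_betw_inv_into)
    show "?g (hzero B) = hzero A" "?g (hone B) = hone A"
      using f assms(2) gf unfolding heyting_iso_def subalgebra_def by metis+
    fix x y assume "x \<in> hcarrier B" "y \<in> hcarrier B"
    then have "x \<in> f ` hcarrier A" "y \<in> f ` hcarrier A"
      using bij by (simp_all add: bij_betw_def)
    then obtain u v where uv: "u \<in> hcarrier A" "v \<in> hcarrier A" "x = f u" "y = f v"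
      by blast
    then show "?g (hmeet B x y) = hmeet A (?g x) (?g y)"
      "?g (hjoin B x y) = hjoin A (?g x) (?g y)" "?g (himp B x y) = himp A (?g x) (?g y)"
      using f assms(2) gf unfolding heyting_iso_def subalgebra_def by metis+
  qed
  then show ?thesis by (auto simp: isomorphic_def)
qed

lemma isomorphic_trans:
  assumes "isomorphic A B" "isomorphic B C"
  shows "isomorphic A C"
proof -
  obtain f g where f: "heyting_iso f A B" and g: "heyting_iso g B C"
    using assms by (auto simp: isomorphic_def)
  have "f x \<in> hcarrier B" if "x \<in> hcarrier A" for x
    using f that by (auto simp: heyting_iso_def bij_betw_def)
  then have "heyting_iso (g \<circ> f) A C"
    using f g bij_betw_trans[of f "hcarrier A" "hcarrier B" g "hcarrier C"]
    by (simp add: heyting_iso_def)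
  then show ?thesis by (auto simp: isomorphic_def)
qed

lemma restrict_algebra_simps [simp]:
  "hcarrier (restrict_algebra A B) = B" "hmeet (restrict_algebra A B) = hmeet A"
  "hjoin (restrict_algebra A B) = hjoin A" "himp (restrict_algebra A B) = himp A"
  "hzero (restrict_algebra A B) = hzero A" "hone (restrict_algebra A B) = hone A"
  by (simp_all add: restrict_algebra_def)

lemma subalgebra_restrict: "subalgebra B A \<Longrightarrow> subalgebra B (restrict_algebra A B)"
  by (simp add: subalgebra_def)

text \<open>The quotient by the isomorphism relation is formed from its images, so isomorphic
  subalgebras have to be shown to have the same image.\<close>

lemma subalgebra_iso_rel_Image_eq:
  assumes "subalgebra B A" "subalgebra C A"
    and "isomorphic (restrict_algebra A B) (restrict_algebra A C)"
  shows "subalgebra_iso_rel A `` {B} = subalgebra_iso_rel A `` {C}"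
proof -
  have "isomorphic (restrict_algebra A C) (restrict_algebra A B)"
    using isomorphic_sym[OF assms(3)] subalgebra_restrict[OF assms(1)] by simp
  then show ?thesis
    using assms isomorphic_trans by (auto simp: subalgebra_iso_rel_def)
qed

text \<open>Numbering the elements of an algebra with at most \<open>m\<close> elements turns its operations into
  tables with entries below \<open>m\<close>. There are finitely many tables, and two algebras with the
  same tables are isomorphic by composing one numbering with the inverse of the other.\<close>

lemma finite_iso_types_if_bounded:
  assumes S: "\<And>B. B \<in> S \<Longrightarrow> subalgebra B A \<and> finite B \<and> card B \<le> m"
  shows "finite (S // subalgebra_iso_rel A)"
proof -
  have "\<exists>h. bij_betw h B {..<card B}" if "B \<in> S" for B
    using ex_bij_betw_finite_nat[of B] S[OF that] by (auto simp: atLeast0LessThan)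
  then obtain h where h: "\<And>B. B \<in> S \<Longrightarrow> bij_betw (h B) B {..<card B}" by metis
  define enc where "enc B = (card B, h B (hzero A), h B (hone A),
    table (h B) B (hmeet A), table (h B) B (hjoin A), table (h B) B (himp A))" for B
  let ?T = "Pow ({..<m} \<times> {..<m} \<times> {..<m})"
  have "enc ` S \<subseteq> {..m} \<times> {..<m} \<times> {..<m} \<times> ?T \<times> ?T \<times> ?T"
  proof
    fix e assume "e \<in> enc ` S"
    then obtain B where B: "B \<in> S" "e = enc B" by blast
    note SB = S[OF B(1)]
    have lt: "h B x < m" if "x \<in> B" for x
    proof -
      have "h B x < card B" using bij_betwE[OF h[OF B(1)]] that by blast
      then show ?thesis using SB by linarith
    qed
    have "table (h B) B f \<in> ?T" if "\<forall>x\<in>B. \<forall>y\<in>B. f x y \<in> B" for f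
      using that lt by (auto simp: table_def)
    then show "e \<in> {..m} \<times> {..<m} \<times> {..<m} \<times> ?T \<times> ?T \<times> ?T"
      using SB lt unfolding B enc_def subalgebra_def by simp
  qed
  then have fin: "finite (enc ` S)" by (rule finite_subset) simp
  have same: "subalgebra_iso_rel A `` {B} = subalgebra_iso_rel A `` {C}"
    if BC: "B \<in> S" "C \<in> S" "enc B = enc C" for B C
  proof -
    have sB: "subalgebra B A" and sC: "subalgebra C A" using S BC by auto
    have e: "card B = card C" "h B (hzero A) = h C (hzero A)" "h B (hone A) = h C (hone A)"
      "table (h B) B (hmeet A) = table (h C) C (hmeet A)"
      "table (h B) B (hjoin A) = table (h C) C (hjoin A)"
      "table (h B) B (himp A) = table (h C) C (himp A)"
      using BC(3) by (simp_all add: enc_def)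
    have hB: "bij_betw (h B) B {..<card C}" and hC: "bij_betw (h C) C {..<card C}"
      using h[OF BC(1)] h[OF BC(2)] e(1) by simp_all
    let ?f = "inv_into C (h C) \<circ> h B"
    have "heyting_iso ?f (restrict_algebra A B) (restrict_algebra A C)"
      unfolding heyting_iso_def restrict_algebra_simps
    proof (intro conjI ballI)
      show "bij_betw ?f B C" using bij_betw_trans[OF hB bij_betw_inv_into[OF hC]] .
      show "?f (hzero A) = hzero A" "?f (hone A) = hone A"
        using e(2,3) hC sC by (simp_all add: bij_betw_def inv_into_f_f subalgebra_def)
      fix x y assume xy: "x \<in> B" "y \<in> B"
      show "?f (hmeet A x y) = hmeet A (?f x) (?f y)"
        using table_transfer[OF hB hC _ _ e(4) xy] sB sC by (simp add: subalgebra_def)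
      show "?f (hjoin A x y) = hjoin A (?f x) (?f y)"
        using table_transfer[OF hB hC _ _ e(5) xy] sB sC by (simp add: subalgebra_def)
      show "?f (himp A x y) = himp A (?f x) (?f y)"
        using table_transfer[OF hB hC _ _ e(6) xy] sB sC by (simp add: subalgebra_def)
    qed
    then show ?thesis
      using sB sC by (intro subalgebra_iso_rel_Image_eq) (auto simp: isomorphic_def)
  qed
  let ?c = "\<lambda>e. subalgebra_iso_rel A `` {SOME B. B \<in> S \<and> enc B = e}"
  have "S // subalgebra_iso_rel A \<subseteq> ?c ` enc ` S"
  proof
    fix X assume "X \<in> S // subalgebra_iso_rel A"
    then obtain B where B: "B \<in> S" "X = subalgebra_iso_rel A `` {B}" by (auto simp: quotient_def)
    let ?B = "SOME C. C \<in> S \<and> enc C = enc B"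
    have "?B \<in> S \<and> enc ?B = enc B" using someI[of "\<lambda>C. C \<in> S \<and> enc C = enc B" B] B(1) by simp
    then have "X = ?c (enc B)" using same[of B ?B] B by simp
    then show "X \<in> ?c ` enc ` S" using B(1) by blast
  qed
  then show ?thesis using fin finite_subset by blast
qed

section \<open>Generation by one element more than the index\<close>

definition tops :: "(nat \<Rightarrow> bool) \<Rightarrow> nat \<Rightarrow> point set" where
  "tops p n = {Pt l 0 | l. l < 2 ^ n \<and> p l}"

text \<open>All points of level 0 but the last one, and for each \<open>j < n\<close> those among them whose index
  has bit \<open>j\<close> set. These \<open>n + 1\<close> sets separate the points of level 0. The last point belongs
  to none of them, whereas the point 0 belongs to one: for \<open>n = 0\<close> the point 0 of level 1 sees
  only the point 0 of level 0, and is told apart from the last point of level 0 by this alone.\<close>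

definition ladder_gens :: "nat \<Rightarrow> point set set" where
  "ladder_gens n = insert (tops (\<lambda>_. True) n) ((\<lambda>j. tops (\<lambda>l. bit l j) n) ` {..<n})"

lemma tops_fin_upset: "fin_upset n (tops p n)"
proof -
  have "tops p n = (\<lambda>l. Pt l 0) ` {l. l < 2 ^ n \<and> p l}" by (auto simp: tops_def)
  then have "finite (tops p n)" by simp
  moreover have "upset (P n) (E_le n) (tops p n)"
    unfolding upset_def
  proof (intro conjI ballI subsetI)
    fix x y assume "x \<in> tops p n" "y \<in> up (P n) (E_le n) x"
    then show "y \<in> tops p n" by (cases y) (auto simp: tops_def up_def)
  qed (auto simp: tops_def)
  ultimately show ?thesis by (auto simp: fin_upset_def tops_def)
qed

lemma mem_tops [simp]: "Pt l i \<in> tops p n \<longleftrightarrow> i = 0 \<and> l < 2 ^ n \<and> p l"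
  by (auto simp: tops_def)

lemma ladder_gens_carrier: "ladder_gens n \<subseteq> hcarrier (H n)"
  using tops_fin_upset by (auto simp: ladder_gens_def carrier_H)

lemma card_ladder_gens: "card (ladder_gens n) = n + 1"
proof -
  let ?V = "\<lambda>j. tops (\<lambda>l. bit l j) n"
  have *: "Pt (2 ^ i) 0 \<in> ?V j \<longleftrightarrow> i = j" if "i < n" for i j
    using that by (auto simp: bit_exp_iff)
  have "inj_on ?V {..<n}"
  proof (rule inj_onI)
    fix i j assume ij: "i \<in> {..<n}" "?V i = ?V j"
    then have "Pt (2 ^ i) 0 \<in> ?V j" using *[of i i] by simp
    then show "i = j" using * ij by blast
  qed
  then have "card (?V ` {..<n}) = n" by (simp add: card_image)
  moreover have "Pt 0 0 \<in> tops (\<lambda>_. True) n" "Pt 0 0 \<notin> ?V j" for j by auto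
  then have "tops (\<lambda>_. True) n \<notin> ?V ` {..<n}" by blast
  ultimately show ?thesis by (simp add: ladder_gens_def)
qed

context
  fixes n :: nat and B :: "point set set"
  assumes sub: "subalgebra B (H n)"
begin

lemma subalgebra_H_closed:
  "U \<in> B \<Longrightarrow> V \<in> B \<Longrightarrow> U \<inter> V \<in> B"
  "U \<in> B \<Longrightarrow> V \<in> B \<Longrightarrow> U \<union> V \<in> B"
  "U \<in> B \<Longrightarrow> V \<in> B \<Longrightarrow> P n - down (P n) (E_le n) (U - V) \<in> B"
  "{} \<in> B" "P n \<in> B"
  using sub by (auto simp: subalgebra_def)

lemma subalgebra_H_Union: "finite X \<Longrightarrow> (\<And>x. x \<in> X \<Longrightarrow> f x \<in> B) \<Longrightarrow> (\<Union>x\<in>X. f x) \<in> B"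
  by (induction X rule: finite_induct) (auto intro: subalgebra_H_closed)

lemma fin_upset_if_principals:
  assumes "fin_upset n U" "\<And>l i. Pt l i \<in> U \<Longrightarrow> up (P n) (E_le n) (Pt l i) \<in> B"
  shows "U \<in> B"
proof -
  have "(\<Union>x\<in>U. up (P n) (E_le n) x) \<in> B"
  proof (rule subalgebra_H_Union)
    fix x assume "x \<in> U"
    then show "up (P n) (E_le n) x \<in> B"
      using assms by (cases x) (auto simp: fin_upset_def)
  qed (use assms in \<open>simp add: fin_upset_def\<close>)
  then show ?thesis using fin_upset_eq_Union[OF assms(1)] by simp
qed

text \<open>The last point of a level sees everything above it. With \<open>L\<close> the levels above and \<open>Y\<close> the
  union of \<open>L\<close> with the other points of the level, \<open>Y \<rightarrow> L\<close> consists of the points that are not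
  below one of those others. This excludes all the deeper points, since every one of them is
  below the point 0 of the level, so only the last point is added to \<open>L\<close>.\<close>

lemma principal_of_last_point:
  assumes below: "\<And>l j. l \<le> 2 ^ n \<Longrightarrow> j < i \<Longrightarrow> up (P n) (E_le n) (Pt l j) \<in> B"
    and level: "\<And>l. l < 2 ^ n \<Longrightarrow> up (P n) (E_le n) (Pt l i) \<in> B"
  shows "up (P n) (E_le n) (Pt (2 ^ n) i) \<in> B"
proof -
  let ?N = "2 ^ n :: nat"
  let ?L = "{Pt l j | l j. l \<le> ?N \<and> j < i}"
  let ?Y = "?L \<union> {Pt l i | l. l < ?N}"
  have fin: "finite ?Y"
  proof (rule finite_subset[OF _ finite_levels_upto[of n i]], rule subsetI)
    fix x assume "x \<in> ?Y" then show "x \<in> levels_upto n i" by (cases x) auto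
  qed
  then have finL: "finite ?L" by simp
  have "upset (P n) (E_le n) ?L"
    unfolding upset_def
  proof (intro conjI ballI subsetI)
    fix x y assume "x \<in> ?L" "y \<in> up (P n) (E_le n) x"
    then show "y \<in> ?L" by (cases y) (auto simp: up_def)
  qed auto
  then have "fin_upset n ?L" using finL unfolding fin_upset_def by blast
  then have L: "?L \<in> B" by (rule fin_upset_if_principals) (use below in blast)
  have "upset (P n) (E_le n) ?Y"
    unfolding upset_def
  proof (intro conjI ballI subsetI)
    fix x y assume "x \<in> ?Y" "y \<in> up (P n) (E_le n) x"
    then show "y \<in> ?Y" by (cases y) (auto simp: up_def)
  qed auto
  then have "fin_upset n ?Y" using fin unfolding fin_upset_def by blast
  then have Y: "?Y \<in> B" by (rule fin_upset_if_principals) (use below level in blast)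
  have "P n - down (P n) (E_le n) (?Y - ?L) = up (P n) (E_le n) (Pt ?N i)" (is "?I = ?U")
  proof (rule set_eqI)
    fix x
    have diff: "?Y - ?L = {Pt l i | l. l < ?N}" by auto
    show "x \<in> ?I \<longleftrightarrow> x \<in> ?U"
    proof (cases x)
      case (Pt a j)
      have pos: "0 < ?N" by simp
      have "(\<forall>l < ?N. \<not> E_le n (Pt a j) (Pt l i)) \<longleftrightarrow> E_le n (Pt ?N i) (Pt a j)" if a: "a \<le> ?N"
      proof -
        consider "j < i" | "j = i" | "i < j" by linarith
        then show ?thesis
        proof cases
          case 3
          then have "E_le n (Pt a j) (Pt 0 i)" using a by (auto simp: not_less_eq_eq)
          moreover have "\<not> E_le n (Pt ?N i) (Pt a j)" using 3 by auto
          ultimately show ?thesis using pos by blast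
        next
          case 2
          have "(\<forall>l<?N. a \<noteq> l) \<longleftrightarrow> a = ?N" using a by (metis le_neq_implies_less less_irrefl)
          then show ?thesis using a 2 by auto
        qed (use a in auto)
      qed
      moreover have "x \<in> P n - down (P n) (E_le n) {Pt l i | l. l < ?N} \<longleftrightarrow>
          a \<le> ?N \<and> (\<forall>l < ?N. \<not> E_le n (Pt a j) (Pt l i))"
        by (auto simp: Pt down_def simp del: E_le_simps)
      moreover have "x \<in> ?U \<longleftrightarrow> a \<le> ?N \<and> E_le n (Pt ?N i) (Pt a j)"
        by (simp add: Pt up_def del: E_le_simps)
      ultimately show ?thesis unfolding diff by blast
    next
      case Inf_pt
      then show ?thesis unfolding diff by (auto simp: down_def up_def intro!: exI[of _ "Pt 0 i"])
    qed
  qed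
  moreover have "?I \<in> B" by (rule subalgebra_H_closed(3)[OF Y L])
  ultimately show ?thesis by simp
qed

text \<open>The point \<open>a < 2 ^ n\<close> of level \<open>j + 1\<close> is the only one below level \<open>j\<close> that does not lie
  below the point \<open>a + 1\<close> of level \<open>j\<close>. Its principal upset is therefore \<open>Q \<rightarrow> R\<close>, where \<open>Q\<close> is
  the principal upset of \<open>Pt (a + 1) j\<close> and \<open>R\<close> consists of the levels up to \<open>j\<close> without that
  point: then \<open>Q - R\<close> is a singleton.\<close>

lemma principals_generated_by_tops:
  assumes base: "\<And>l. l < 2 ^ n \<Longrightarrow> up (P n) (E_le n) (Pt l 0) \<in> B"
    and "l \<le> 2 ^ n"
  shows "up (P n) (E_le n) (Pt l i) \<in> B"
  using assms(2)
proof (induction i arbitrary: l rule: less_induct)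
  case (less i)
  have "up (P n) (E_le n) (Pt a i) \<in> B" if a: "a < 2 ^ n" for a
  proof (cases i)
    case 0
    then show ?thesis using base a by simp
  next
    case (Suc j)
    let ?R = "levels_upto n j - {Pt (Suc a) j}"
    have "upset (P n) (E_le n) ?R"
      unfolding upset_def
    proof (intro conjI ballI subsetI)
      fix x y assume "x \<in> ?R" "y \<in> up (P n) (E_le n) x"
      then show "y \<in> ?R" by (cases x; cases y) (auto simp: up_def)
    qed (auto simp: levels_upto_def)
    then have "fin_upset n ?R"
      using finite_levels_upto[of n j] by (simp add: fin_upset_def)
    then have R: "?R \<in> B"
    proof (rule fin_upset_if_principals)
      fix b m assume "Pt b m \<in> ?R"
      then have "b \<le> 2 ^ n" "m < i" using Suc by simp_all
      then show "up (P n) (E_le n) (Pt b m) \<in> B" using less.IH by blast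
    qed
    have Q: "up (P n) (E_le n) (Pt (Suc a) j) \<in> B" using less.IH Suc a by simp
    have diff: "up (P n) (E_le n) (Pt (Suc a) j) - ?R = {Pt (Suc a) j}"
    proof (rule set_eqI)
      fix x show "x \<in> up (P n) (E_le n) (Pt (Suc a) j) - ?R \<longleftrightarrow> x \<in> {Pt (Suc a) j}"
        using a by (cases x) (auto simp: up_def)
    qed
    have "P n - down (P n) (E_le n) {Pt (Suc a) j} = up (P n) (E_le n) (Pt a (Suc j))"
    proof (rule set_eqI)
      fix x show "x \<in> P n - down (P n) (E_le n) {Pt (Suc a) j} \<longleftrightarrow>
          x \<in> up (P n) (E_le n) (Pt a (Suc j))"
        using a by (cases x) (auto simp: up_def down_def)
    qed
    then show ?thesis using subalgebra_H_closed(3)[OF Q R] diff Suc by simp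
  qed
  moreover from this have "up (P n) (E_le n) (Pt (2 ^ n) i) \<in> B"
    using less.IH by (intro principal_of_last_point) auto
  ultimately show ?case using less.prems by (cases "l = 2 ^ n") auto
qed

text \<open>A point of level 0 is cut out by its bits one after the other, using a generator where the
  bit is set and its pseudocomplement where it is not.\<close>

lemma principals_of_tops:
  assumes "ladder_gens n \<subseteq> B" "l < 2 ^ n"
  shows "up (P n) (E_le n) (Pt l 0) \<in> B"
proof -
  let ?T = "\<lambda>t. tops (\<lambda>a. \<forall>j<t. bit a j = bit l j) n"
  have "t \<le> n \<Longrightarrow> ?T t \<in> B" for t
  proof (induction t)
    case 0
    then show ?case using assms(1) by (simp add: ladder_gens_def)
  next
    case (Suc t)
    let ?V = "tops (\<lambda>a. bit a t) n"
    have V: "?V \<in> B" and T: "?T t \<in> B" using Suc assms(1) by (auto simp: ladder_gens_def)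
    show ?case
    proof (cases "bit l t")
      case True
      then have "?T (Suc t) = ?T t \<inter> ?V" by (auto simp: tops_def less_Suc_eq)
      then show ?thesis using subalgebra_H_closed(1)[OF T V] by simp
    next
      case False
      have "Pt a 0 \<in> down (P n) (E_le n) (?V - {}) \<longleftrightarrow> bit a t" if "a < 2 ^ n" for a
        using that by (auto simp: tops_def down_def intro!: exI[of _ "Pt a 0"])
      then have "?T (Suc t) = ?T t \<inter> (P n - down (P n) (E_le n) (?V - {}))"
        using False by (auto simp: tops_def less_Suc_eq)
      then show ?thesis using subalgebra_H_closed(1)[OF T subalgebra_H_closed(3)[OF V subalgebra_H_closed(4)]] by simp
    qed
  qed
  then have "?T n \<in> B" by simp
  moreover have "?T n = up (P n) (E_le n) (Pt l 0)"
  proof (rule set_eqI)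
    fix x
    have eq: "a = l" if "a < 2 ^ n" "\<forall>j<n. bit a j = bit l j" for a
    proof -
      have "take_bit n a = take_bit n l"
        using that(2) by (auto simp: bit_eq_iff bit_take_bit_iff)
      then show ?thesis using that(1) assms(2) by (simp add: take_bit_nat_eq_self)
    qed
    show "x \<in> ?T n \<longleftrightarrow> x \<in> up (P n) (E_le n) (Pt l 0)"
    proof (cases x)
      case (Pt a j)
      have "j = 0 \<and> a < 2 ^ n \<and> (\<forall>j<n. bit a j = bit l j) \<longleftrightarrow> j = 0 \<and> a = l"
        using eq[of a] assms(2) by blast
      then show ?thesis using assms(2) by (auto simp: Pt up_def)
    qed (simp add: up_def tops_def)
  qed
  ultimately show ?thesis by simp
qed

end

lemma k_generated_H: "k_generated (H n) (n + 1)"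
proof -
  let ?B = "generated (H n) (ladder_gens n)"
  have sub: "subalgebra ?B (H n)" and gens: "ladder_gens n \<subseteq> ?B"
    using generated_subalgebra[OF subalgebra_carrier_H ladder_gens_carrier] by auto
  have base: "up (P n) (E_le n) (Pt l 0) \<in> ?B" if "l < 2 ^ n" for l
    using principals_of_tops[OF sub gens that] .
  have "U \<in> ?B" if U: "fin_upset n U" for U
  proof (rule fin_upset_if_principals[OF sub U])
    fix l i assume "Pt l i \<in> U"
    then have "l \<le> 2 ^ n" using U carrier_subset[of U n] by (auto simp: carrier_H)
    then show "up (P n) (E_le n) (Pt l i) \<in> ?B"
      using principals_generated_by_tops[OF sub base] by blast
  qed
  moreover have "P n \<in> ?B" using subalgebra_H_closed(5)[OF sub] .
  ultimately have "hcarrier (H n) \<subseteq> ?B" unfolding carrier_H by blast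
  then have "?B = hcarrier (H n)" using sub unfolding subalgebra_def by blast
  moreover have "finite (ladder_gens n)" by (simp add: ladder_gens_def)
  ultimately show ?thesis unfolding k_generated_def
    using ladder_gens_carrier[of n] card_ladder_gens[of n] by blast
qed

section \<open>An equivalence relation respecting given generators\<close>

definition color :: "point set set \<Rightarrow> nat \<Rightarrow> nat \<Rightarrow> point set set" where
  "color G i l = {U \<in> G. Pt l i \<in> U}"

text \<open>The elements of \<open>C\<close> stand for points of level \<open>i\<close>.\<close>

definition twins :: "point set set \<Rightarrow> nat \<Rightarrow> nat set \<Rightarrow> nat set" where
  "twins G i C = {l \<in> C. \<exists>l'\<in>C. l' \<noteq> l \<and> color G i l' = color G i l}"

text \<open>A point of level \<open>i + 1\<close> sees all of level \<open>i\<close> up to equivalence if it is the last point,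
  which misses nothing, or the point that it misses has a twin. Points of level 0 have nothing
  above them to miss.\<close>

primrec blind :: "nat \<Rightarrow> point set set \<Rightarrow> nat \<Rightarrow> nat set" where
  "blind n G 0 = {..2 ^ n}"
| "blind n G (Suc i) = {l. l \<le> 2 ^ n \<and> (l = 2 ^ n \<or> Suc l \<in> twins G i (blind n G i))}"

text \<open>Levels \<open>i\<close> and \<open>i + 1\<close> can be merged into one class if all their points have the same colour
  and no point of level \<open>i\<close> notices what it misses on level \<open>i - 1\<close>. Points of level \<open>i + 1\<close>
  see all of that level anyway.\<close>

definition glued :: "nat \<Rightarrow> point set set \<Rightarrow> nat \<Rightarrow> bool" where
  "glued n G i \<longleftrightarrow>
     (\<forall>l\<le>2 ^ n. \<forall>l'\<le>2 ^ n. color G (Suc i) l = color G i l') \<and>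
     (\<forall>j. i = Suc j \<longrightarrow> {..2 ^ n} \<subseteq> twins G j (blind n G j))"

text \<open>Only generating pairs are listed: a set saturated for them is saturated for the equivalence
  relation which they generate.\<close>

inductive identified :: "nat \<Rightarrow> point set set \<Rightarrow> point \<Rightarrow> point \<Rightarrow> bool" for n G where
  same_level: "identified n G (Pt l i) (Pt l' i)"
    if "l \<in> blind n G i" "l' \<in> blind n G i" "color G i l = color G i l'"
| next_level: "identified n G (Pt l (Suc i)) (Pt l' i)"
    if "glued n G i" "l \<le> 2 ^ n" "l' \<le> 2 ^ n"

definition saturated :: "nat \<Rightarrow> point set set \<Rightarrow> point set \<Rightarrow> bool" where
  "saturated n G W \<longleftrightarrow> (\<forall>x y. identified n G x y \<longrightarrow> (x \<in> W \<longleftrightarrow> y \<in> W))"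

lemma blind_le: "l \<in> blind n G i \<Longrightarrow> l \<le> 2 ^ n"
  by (cases i) auto

lemma finite_blind: "finite (blind n G i)"
  by (rule finite_subset[of _ "{..2 ^ n}"]) (auto intro: blind_le)

lemma saturated_same_color:
  "saturated n G W \<Longrightarrow> l \<in> blind n G i \<Longrightarrow> l' \<in> blind n G i \<Longrightarrow>
     color G i l = color G i l' \<Longrightarrow> Pt l i \<in> W \<Longrightarrow> Pt l' i \<in> W"
  using identified.same_level unfolding saturated_def by blast

lemma saturated_glued:
  "saturated n G W \<Longrightarrow> glued n G i \<Longrightarrow> l \<le> 2 ^ n \<Longrightarrow> l' \<le> 2 ^ n \<Longrightarrow>
     Pt l (Suc i) \<in> W \<longleftrightarrow> Pt l' i \<in> W"
  using identified.next_level unfolding saturated_def by blast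

text \<open>The way out for a point that fails to see \<open>Pt m j\<close>: it sees a twin, as each point misses at
  most one point of the level above.\<close>

lemma saturated_twin:
  assumes "saturated n G W" "Pt m j \<in> W" "m \<in> twins G j (blind n G j)"
  obtains b where "b \<le> 2 ^ n" "b \<noteq> m" "Pt b j \<in> W"
proof -
  obtain b where b: "m \<in> blind n G j" "b \<in> blind n G j" "b \<noteq> m" "color G j b = color G j m"
    using assms(3) by (auto simp: twins_def)
  then have "Pt b j \<in> W" using saturated_same_color[OF assms(1), of m j b] assms(2) by simp
  then show ?thesis using that b blind_le by blast
qed

lemma in_down_Pt:
  "Pt l i \<in> down (P n) (E_le n) W \<longleftrightarrow> (\<exists>m j. Pt m j \<in> W \<and> E_le n (Pt l i) (Pt m j))"
  (is "?L = ?R")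
proof
  assume ?L
  then obtain y where y: "y \<in> W" "E_le n (Pt l i) y" by (auto simp: down_def simp del: E_le_simps)
  then show ?R by (cases y) auto
next
  assume ?R
  then show ?L
    using E_le_in_P[of n "Pt l i"] by (auto simp: down_def simp del: E_le_simps P_simps)
qed

text \<open>This is the back-and-forth property of the identification, phrased for saturated sets: if
  \<open>x\<close> is identified with \<open>y\<close> and lies below a point of \<open>W\<close>, then \<open>y\<close> lies below a point of \<open>W\<close>
  as well. The only case in which the same point of \<open>W\<close> does not serve for both is that \<open>y\<close>
  misses it on the level immediately above, and then blindness provides a twin.\<close>

lemma saturated_down:
  assumes sat: "saturated n G W" shows "saturated n G (down (P n) (E_le n) W)"
proof -
  let ?D = "down (P n) (E_le n) W"
  have same: "Pt l' i \<in> ?D"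
    if l: "l \<in> blind n G i" "l' \<in> blind n G i" "color G i l = color G i l'" "Pt l i \<in> ?D"
    for i l l'
  proof -
    have l': "l' \<le> 2 ^ n" using l(2) by (rule blind_le)
    obtain m j where m: "Pt m j \<in> W" "E_le n (Pt l i) (Pt m j)"
      using l(4) in_down_Pt by blast
    then have mN: "m \<le> 2 ^ n" by simp
    have "(l = m \<and> i = j) \<or> E_le n (Pt l' i) (Pt m j) \<or> (i = Suc j \<and> m = Suc l')"
      using m(2) l' by auto
    then consider "l = m" "i = j" | "E_le n (Pt l' i) (Pt m j)" | "i = Suc j" "m = Suc l'"
      by blast
    then show ?thesis
    proof cases
      case 1
      then have "Pt l' i \<in> W" using saturated_same_color[OF sat l(1-3)] m(1) by simp
      moreover have "E_le n (Pt l' i) (Pt l' i)" using l' by simp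
      ultimately show ?thesis unfolding in_down_Pt by blast
    next
      case 2
      then show ?thesis using m(1) unfolding in_down_Pt by blast
    next
      case 3
      then have "m \<in> twins G j (blind n G j)" using l(2) mN by auto
      then obtain b where "b \<le> 2 ^ n" "b \<noteq> m" "Pt b j \<in> W"
        using saturated_twin[OF sat m(1)] by blast
      moreover from this have "E_le n (Pt l' i) (Pt b j)" using 3 l' by simp
      ultimately show ?thesis unfolding in_down_Pt by blast
    qed
  qed
  have glue: "Pt l (Suc i) \<in> ?D \<longleftrightarrow> Pt l' i \<in> ?D"
    if g: "glued n G i" and l: "l \<le> 2 ^ n" "l' \<le> 2 ^ n" for i l l'
  proof
    assume "Pt l (Suc i) \<in> ?D"
    then obtain m j where m: "Pt m j \<in> W" "E_le n (Pt l (Suc i)) (Pt m j)"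
      using in_down_Pt by blast
    then have mN: "m \<le> 2 ^ n" by simp
    have "(l = m \<and> j = Suc i) \<or> j = i \<or> E_le n (Pt l' i) (Pt m j) \<or>
        (i = Suc j \<and> m = Suc l')"
      using m(2) l by auto
    then consider "l = m" "j = Suc i" | "j = i" | "E_le n (Pt l' i) (Pt m j)"
      | "i = Suc j" "m = Suc l'"
      by blast
    then show "Pt l' i \<in> ?D"
    proof cases
      case 1
      then have "Pt l' i \<in> W" using saturated_glued[OF sat g l] m(1) by simp
      moreover have "E_le n (Pt l' i) (Pt l' i)" using l by simp
      ultimately show ?thesis unfolding in_down_Pt by blast
    next
      case 2
      then have "Pt l (Suc i) \<in> W" using saturated_glued[OF sat g l(1) mN] m(1) by simp
      then have "Pt l' i \<in> W" using saturated_glued[OF sat g l] by simp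
      moreover have "E_le n (Pt l' i) (Pt l' i)" using l by simp
      ultimately show ?thesis unfolding in_down_Pt by blast
    next
      case 3
      then show ?thesis using m(1) unfolding in_down_Pt by blast
    next
      case 4
      then have "m \<in> twins G j (blind n G j)" using g mN by (auto simp: glued_def)
      then obtain b where "b \<le> 2 ^ n" "b \<noteq> m" "Pt b j \<in> W"
        using saturated_twin[OF sat m(1)] by blast
      moreover from this have "E_le n (Pt l' i) (Pt b j)" using 4 l by simp
      ultimately show ?thesis unfolding in_down_Pt by blast
    qed
  next
    assume "Pt l' i \<in> ?D"
    then obtain m j where m: "Pt m j \<in> W" "E_le n (Pt l' i) (Pt m j)"
      using in_down_Pt by blast
    consider "l' = m" "j = i" | "E_le n (Pt l (Suc i)) (Pt m j)"
      using m(2) l by auto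
    then show "Pt l (Suc i) \<in> ?D"
    proof cases
      case 1
      then have "Pt l (Suc i) \<in> W" using saturated_glued[OF sat g l] m(1) by simp
      moreover have "E_le n (Pt l (Suc i)) (Pt l (Suc i))" using l by simp
      ultimately show ?thesis unfolding in_down_Pt by blast
    next
      case 2
      then show ?thesis using m(1) unfolding in_down_Pt by blast
    qed
  qed
  show ?thesis unfolding saturated_def
  proof (intro allI impI)
    fix x y assume "identified n G x y"
    then show "x \<in> ?D \<longleftrightarrow> y \<in> ?D"
    proof cases
      case (same_level l i l')
      note l = same_level(3-5)
      have "Pt l i \<in> ?D \<longleftrightarrow> Pt l' i \<in> ?D"
        using same[OF l] same[OF l(2,1) l(3)[symmetric]] by (rule iffI)
      then show ?thesis using same_level(1,2) by simp
    next
      case (next_level i l l')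
      then show ?thesis using glue[of i l l'] by simp
    qed
  qed
qed

lemma saturated_Boolean:
  assumes "saturated n G U" "saturated n G V"
  shows "saturated n G (U \<inter> V)" "saturated n G (U \<union> V)" "saturated n G (U - V)"
  using assms unfolding saturated_def by blast+

lemma saturated_P: "saturated n G (P n)"
  unfolding saturated_def by (auto elim!: identified.cases dest: blind_le)

lemma saturated_empty: "saturated n G {}"
  by (simp add: saturated_def)

lemma saturated_generator:
  assumes "U \<in> G" shows "saturated n G U"
  unfolding saturated_def
proof (intro allI impI)
  fix x y assume "identified n G x y"
  then show "x \<in> U \<longleftrightarrow> y \<in> U"
  proof cases
    case (same_level l i l')
    then show ?thesis using assms unfolding color_def by blast
  next
    case (next_level i l l')
    then show ?thesis using assms unfolding glued_def color_def by blast
  qed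
qed

definition saturated_sets :: "nat \<Rightarrow> point set set \<Rightarrow> point set set" where
  "saturated_sets n G = {U \<in> hcarrier (H n). saturated n G U}"

lemma subalgebra_saturated_sets: "subalgebra (saturated_sets n G) (H n)"
  unfolding subalgebra_def
proof (intro conjI ballI)
  have H: "subalgebra (hcarrier (H n)) (H n)" by (rule subalgebra_carrier_H)
  show "saturated_sets n G \<subseteq> hcarrier (H n)" by (auto simp: saturated_sets_def)
  show "hzero (H n) \<in> saturated_sets n G" "hone (H n) \<in> saturated_sets n G"
    using H saturated_P[of n G] saturated_empty[of n G]
    unfolding subalgebra_def saturated_sets_def by simp_all
  fix U V assume "U \<in> saturated_sets n G" "V \<in> saturated_sets n G"
  then have U: "U \<in> hcarrier (H n)" "V \<in> hcarrier (H n)" "saturated n G U" "saturated n G V"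
    by (auto simp: saturated_sets_def)
  show "hmeet (H n) U V \<in> saturated_sets n G" "hjoin (H n) U V \<in> saturated_sets n G"
    "himp (H n) U V \<in> saturated_sets n G"
    using U H saturated_Boolean[OF U(3,4)]
      saturated_Boolean(3)[OF saturated_P saturated_down[OF saturated_Boolean(3)[OF U(3,4)]]]
    unfolding subalgebra_def saturated_sets_def by auto
qed

text \<open>The levels that are not glued to the previous one; a saturated set is determined by its
  points on them.\<close>

definition base_levels :: "nat \<Rightarrow> point set set \<Rightarrow> nat set" where
  "base_levels n G = insert 0 (Suc ` {i. \<not> glued n G i})"

definition base_points :: "nat \<Rightarrow> point set set \<Rightarrow> point set" where
  "base_points n G = (\<lambda>(l, i). Pt l i) ` ({..2 ^ n} \<times> base_levels n G)"

text \<open>The limit point belongs to a clopen upset only if all the ladder points do, and conversely,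
  because a clopen upset without the limit point is finite.\<close>

lemma carrier_ext:
  assumes U: "U \<in> hcarrier (H n)" and V: "V \<in> hcarrier (H n)"
    and eq: "\<And>l i. l \<le> 2 ^ n \<Longrightarrow> Pt l i \<in> U \<longleftrightarrow> Pt l i \<in> V"
  shows "U = V"
proof -
  have inf: "Y \<in> hcarrier (H n) \<Longrightarrow> Inf_pt \<in> Y \<longleftrightarrow> {Pt l i | l i. l \<le> (2::nat) ^ n} \<subseteq> Y" for Y
    using points_infinite[of n] by (auto simp: carrier_H fin_upset_def dest: finite_subset)
  show ?thesis
  proof (rule set_eqI)
    fix x show "x \<in> U \<longleftrightarrow> x \<in> V"
    proof (cases x)
      case (Pt l i)
      have "Pt l i \<notin> U \<and> Pt l i \<notin> V" if "\<not> l \<le> 2 ^ n"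
        using that carrier_subset[OF U] carrier_subset[OF V] by auto
      then show ?thesis using eq Pt by blast
    next
      case Inf_pt
      have "{Pt l i | l i. l \<le> (2::nat) ^ n} \<subseteq> U \<longleftrightarrow> {Pt l i | l i. l \<le> (2::nat) ^ n} \<subseteq> V"
        using eq by blast
      then show ?thesis using inf[OF U] inf[OF V] Inf_pt by simp
    qed
  qed
qed

lemma inj_on_base_points: "inj_on (\<lambda>U. U \<inter> base_points n G) (saturated_sets n G)"
proof (rule inj_onI)
  fix U V assume U: "U \<in> saturated_sets n G" and V: "V \<in> saturated_sets n G"
    and eq: "U \<inter> base_points n G = V \<inter> base_points n G"
  have base: "Pt l i \<in> U \<longleftrightarrow> Pt l i \<in> V" if "l \<le> 2 ^ n" "i \<in> base_levels n G" for l i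
  proof -
    have "Pt l i \<in> base_points n G" using that by (auto simp: base_points_def)
    then show ?thesis using eq by blast
  qed
  have "\<forall>l\<le>2 ^ n. Pt l i \<in> U \<longleftrightarrow> Pt l i \<in> V" for i
  proof (induction i)
    case 0
    then show ?case using base by (simp add: base_levels_def)
  next
    case (Suc i)
    show ?case
    proof (cases "glued n G i")
      case True
      then show ?thesis using Suc U V saturated_glued[OF _ True]
        unfolding saturated_sets_def by blast
    next
      case False
      then show ?thesis using base by (simp add: base_levels_def)
    qed
  qed
  then show "U = V" using U V by (intro carrier_ext) (auto simp: saturated_sets_def)
qed

section \<open>Every level keeps blind points\<close>

text \<open>Meaningful only if \<open>U\<close> meets at least one level, but not infinitely many: otherwise the
  maximum is an unspecified number.\<close>

definition depth :: "point set \<Rightarrow> nat" where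
  "depth U = Max {i. \<exists>l. Pt l i \<in> U}"

text \<open>The generators that distinguish some points: the empty set and the whole space colour all
  points alike.\<close>

definition active :: "nat \<Rightarrow> point set \<Rightarrow> bool" where
  "active n U \<longleftrightarrow> fin_upset n U \<and> U \<noteq> {}"

lemma active_levels:
  assumes "active n U" shows "finite {i. \<exists>l. Pt l i \<in> U}" "{i. \<exists>l. Pt l i \<in> U} \<noteq> {}"
proof -
  have U: "finite U" "Inf_pt \<notin> U" "U \<noteq> {}" using assms by (auto simp: active_def fin_upset_def)
  have "{i. \<exists>l. Pt l i \<in> U} \<subseteq> (\<lambda>x. case x of Pt l i \<Rightarrow> i | Inf_pt \<Rightarrow> 0) ` U"
    by (force split: point.splits)
  then show "finite {i. \<exists>l. Pt l i \<in> U}" using U(1) by (rule finite_subset[OF _ finite_imageI])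
  obtain x where "x \<in> U" using U by blast
  then show "{i. \<exists>l. Pt l i \<in> U} \<noteq> {}" using U(2) by (cases x) auto
qed

lemma depth_attained: "active n U \<Longrightarrow> \<exists>l. Pt l (depth U) \<in> U"
  using Max_in[OF active_levels] by (simp add: depth_def)

lemma depth_ge: "active n U \<Longrightarrow> Pt l i \<in> U \<Longrightarrow> i \<le> depth U"
  unfolding depth_def by (rule Max_ge[OF active_levels(1)]) auto

lemma active_upD: "active n U \<Longrightarrow> x \<in> U \<Longrightarrow> E_le n x y \<Longrightarrow> y \<in> U"
  using upset_downD by (auto simp: active_def fin_upset_def simp del: E_le_simps)

lemma active_le: "active n U \<Longrightarrow> Pt l i \<in> U \<Longrightarrow> l \<le> 2 ^ n"
  using carrier_subset[of U n] by (auto simp: active_def carrier_H)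

text \<open>An active set can therefore vary only on the levels \<open>depth U\<close> and \<open>depth U - 1\<close>.\<close>

lemma full_above_depth:
  assumes "active n U" "Suc (Suc i) \<le> depth U" "l \<le> 2 ^ n" shows "Pt l i \<in> U"
proof -
  obtain a where a: "Pt a (depth U) \<in> U" using depth_attained[OF assms(1)] by blast
  then show ?thesis using assms active_upD[OF assms(1) a] active_le[OF assms(1) a] by simp
qed

lemma active_or_trivial: "U \<in> hcarrier (H n) \<Longrightarrow> \<not> active n U \<Longrightarrow> U = {} \<or> U = P n"
  by (auto simp: active_def carrier_H)

text \<open>If an active set \<open>U\<close> omits a point of level \<open>depth U - 1\<close>, it contains just one point of
  level \<open>depth U\<close>, the one that misses the omitted point. In this case \<open>U\<close> is charged to the
  upper of the two levels: on the lower one it separates only a point which is not blind.\<close>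

definition splits_at :: "nat \<Rightarrow> point set \<Rightarrow> nat" where
  "splits_at n U = (if \<exists>i l. depth U = Suc i \<and> l \<le> 2 ^ n \<and> Pt l i \<notin> U
     then depth U - 1 else depth U)"

definition splitters :: "nat \<Rightarrow> point set set \<Rightarrow> nat \<Rightarrow> point set set" where
  "splitters n G i = {U \<in> G. active n U \<and> splits_at n U = i}"

text \<open>Among blind points of level \<open>i\<close> only the generators charged to \<open>i\<close> make a difference. The
  case that needs an argument is a generator of depth \<open>i\<close> charged to \<open>i - 1\<close>. It omits a point
  \<open>q\<close> of level \<open>i - 1\<close>, and by being an upset can contain only the point \<open>q - 1\<close> of level \<open>i\<close>,
  and then contains all of level \<open>i - 1\<close> besides \<open>q\<close>. So \<open>q\<close> has a colour of its own and no
  twin, and \<open>q - 1\<close> is not blind.\<close>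

lemma color_determined:
  assumes G: "G \<subseteq> hcarrier (H n)"
    and l: "l \<in> blind n G i" "l' \<in> blind n G i"
    and eq: "{U \<in> splitters n G i. Pt l i \<in> U} = {U \<in> splitters n G i. Pt l' i \<in> U}"
  shows "color G i l = color G i l'"
proof -
  have "Pt l i \<in> U \<longleftrightarrow> Pt l' i \<in> U" if U: "U \<in> G" for U
  proof (cases "active n U \<and> splits_at n U \<noteq> i")
    case False
    then consider "U = {}" | "U = P n" | "U \<in> splitters n G i"
      using U G active_or_trivial by (auto simp: splitters_def)
    then show ?thesis
    proof cases
      case 3
      then show ?thesis using eq by blast
    qed (use l blind_le in auto)
  next
    case True
    then have act: "active n U" and split: "splits_at n U \<noteq> i" by auto
    consider "depth U < i" | "depth U = i" | "depth U = Suc i" | "Suc (Suc i) \<le> depth U"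
      by linarith
    then show ?thesis
    proof cases
      case 1
      then show ?thesis using depth_ge[OF act] by (metis not_less)
    next
      case 2
      then obtain j q where j: "i = Suc j" "q \<le> 2 ^ n" "Pt q j \<notin> U"
        using split by (auto simp: splits_at_def split: if_splits)
      \<comment> \<open>Here the generator was charged to the level above.\<close>
      have "Pt b i \<notin> U" if b: "b \<in> blind n G i" for b
      proof
        assume bU: "Pt b i \<in> U"
        have others: "Pt a j \<in> U" if "a \<le> 2 ^ n" "a \<noteq> Suc b" for a
          using active_upD[OF act bU] that j(1) blind_le[OF b] by simp
        then have "q = Suc b" using j by blast
        then have "q \<in> twins G j (blind n G j)" using b j by auto
        then obtain a where a: "a \<in> blind n G j" "a \<noteq> q" "color G j a = color G j q"
          by (auto simp: twins_def)
        then have "Pt a j \<in> U" using others blind_le \<open>q = Suc b\<close> by blast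
        then have "U \<in> color G j a" "U \<notin> color G j q" using U j by (auto simp: color_def)
        then show False using a by simp
      qed
      then show ?thesis using l by blast
    next
      case 3
      then have "\<forall>a\<le>2 ^ n. Pt a i \<in> U"
        using split by (auto simp: splits_at_def split: if_splits)
      then show ?thesis using l blind_le by blast
    next
      case 4
      then show ?thesis using full_above_depth[OF act 4] l blind_le by blast
    qed
  qed
  then show ?thesis by (auto simp: color_def)
qed

text \<open>A sharpened pigeonhole principle: the elements that collide with no other element have
  values of their own, and these cannot exhaust \<open>T\<close>, because at least one value is taken by a
  collision.\<close>

lemma card_colliding:
  assumes "finite A" "finite T" "f ` A \<subseteq> T" "card T < card A"
  shows "card A + 1 \<le> card {x \<in> A. \<exists>y\<in>A. y \<noteq> x \<and> f y = f x} + card T"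
proof -
  define D where "D = {x \<in> A. \<exists>y\<in>A. y \<noteq> x \<and> f y = f x}"
  have D: "x \<in> D \<longleftrightarrow> x \<in> A \<and> (\<exists>y\<in>A. y \<noteq> x \<and> f y = f x)" for x
    by (simp add: D_def)
  have inj: "inj_on f (A - D)"
  proof (rule inj_onI)
    fix x y assume "x \<in> A - D" "y \<in> A - D" "f x = f y"
    then show "x = y" using D[of y] by blast
  qed
  have "\<not> inj_on f A"
  proof
    assume "inj_on f A"
    then have "card A \<le> card T" using card_inj_on_le[OF _ assms(3,2)] by blast
    then show False using assms(4) by simp
  qed
  then obtain x y where xy: "x \<in> A" "y \<in> A" "y \<noteq> x" "f y = f x"
    unfolding inj_on_def by metis
  have avoid: "f z \<noteq> f x" if "z \<in> A - D" for z
  proof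
    assume "f z = f x"
    then have fz: "f x = f z" "f y = f z" using xy(4) by simp_all
    have unique: "w = z" if w: "w \<in> A" "f w = f z" for w
    proof (rule ccontr)
      assume "w \<noteq> z"
      then have "\<exists>w\<in>A. w \<noteq> z \<and> f w = f z" using w by (intro bexI[of _ w] conjI)
      then show False using D[of z] \<open>z \<in> A - D\<close> by simp
    qed
    show False using unique[OF xy(1) fz(1)] unique[OF xy(2) fz(2)] xy(3) by simp
  qed
  have "f ` (A - D) \<subseteq> T - {f x}"
  proof (rule image_subsetI)
    fix z assume "z \<in> A - D"
    then show "f z \<in> T - {f x}" using avoid[of z] assms(3) by (simp add: image_subset_iff)
  qed
  then have "card (A - D) \<le> card (T - {f x})"
    using card_image[OF inj] card_mono[of "T - {f x}" "f ` (A - D)"] assms(2) by simp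
  moreover have fx: "f x \<in> T" using xy assms(3) by blast
  then have "card (T - {f x}) = card T - 1" by simp
  moreover have "card (A - D) = card A - card D"
    using assms(1) D by (intro card_Diff_subset) (auto simp: D_def)
  moreover have "card T > 0" using fx assms(2) by (auto simp: card_gt_0_iff)
  ultimately have "card A + 1 \<le> card D + card T" by linarith
  then show ?thesis by (simp only: D_def)
qed

lemma card_twins:
  assumes G: "G \<subseteq> hcarrier (H n)" "finite G"
    and big: "2 ^ card (splitters n G i) < card (blind n G i)"
  shows "card (blind n G i) + 1 \<le>
    card (twins G i (blind n G i)) + 2 ^ card (splitters n G i)"
proof -
  let ?C = "blind n G i" and ?f = "\<lambda>l. {U \<in> splitters n G i. Pt l i \<in> U}"
  let ?D = "{l \<in> ?C. \<exists>l'\<in>?C. l' \<noteq> l \<and> ?f l' = ?f l}"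
  have fin: "finite (splitters n G i)" using G(2) by (simp add: splitters_def)
  have "card ?C + 1 \<le> card ?D + card (Pow (splitters n G i))"
    using big fin by (intro card_colliding finite_blind) (auto simp: card_Pow)
  moreover have "?D \<subseteq> twins G i ?C"
    using color_determined[OF G(1)] unfolding twins_def by blast
  then have "card ?D \<le> card (twins G i ?C)"
    by (intro card_mono) (auto simp: twins_def finite_blind)
  ultimately show ?thesis using fin by (simp add: card_Pow)
qed

text \<open>Going one level down, the twin \<open>l > 0\<close> makes \<open>l - 1\<close> blind. A twin 0 is missed by no point,
  which is made up for by the last point of the new level.\<close>

lemma card_blind_Suc: "card (twins G i (blind n G i)) \<le> card (blind n G (Suc i))"
proof -
  let ?T = "twins G i (blind n G i)"
  have fin: "finite ?T" and le: "\<And>l. l \<in> ?T \<Longrightarrow> l \<le> 2 ^ n"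
    using finite_blind blind_le by (auto simp: twins_def)
  define f where "f l = (if l = 0 then 2 ^ n else l - 1)" for l :: nat
  have "inj_on f ?T"
  proof (rule inj_onI)
    fix a b assume "a \<in> ?T" "b \<in> ?T" "f a = f b"
    moreover have "a \<le> 2 ^ n" "b \<le> 2 ^ n" using calculation le by auto
    ultimately show "a = b" by (auto simp: f_def split: if_splits)
  qed
  moreover have "f ` ?T \<subseteq> blind n G (Suc i)"
  proof
    fix x assume "x \<in> f ` ?T"
    then obtain l where l: "l \<in> ?T" "x = f l" by blast
    then show "x \<in> blind n G (Suc i)" using le[OF l(1)] by (cases l) (auto simp: f_def)
  qed
  ultimately show ?thesis using card_inj_on_le finite_blind by blast
qed

text \<open>This is \<open>(2 ^ a - 1) * (2 ^ b - 1) \<ge> 0\<close>. It says that generators separate the most points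
  when they all act on the same level.\<close>

lemma two_powers: "(2::nat) ^ a + 2 ^ b \<le> 2 ^ (a + b) + 1"
proof -
  have "int (2 ^ a - 1) * int (2 ^ b - 1) \<ge> 0" by simp
  then have "0 \<le> (int (2 ^ a) - 1) * (int (2 ^ b) - 1)" by (simp add: of_nat_diff)
  then have "int (2 ^ a + 2 ^ b) \<le> int (2 ^ (a + b) + 1)"
    by (simp add: algebra_simps power_add)
  then show ?thesis by linarith
qed

definition spent :: "nat \<Rightarrow> point set set \<Rightarrow> nat \<Rightarrow> nat" where
  "spent n G i = card {U \<in> G. active n U \<and> splits_at n U < i}"

lemma spent_Suc: "finite G \<Longrightarrow> spent n G (Suc i) = spent n G i + card (splitters n G i)"
proof -
  assume "finite G"
  moreover have "{U \<in> G. active n U \<and> splits_at n U < Suc i} =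
      {U \<in> G. active n U \<and> splits_at n U < i} \<union> splitters n G i"
    by (auto simp: splitters_def)
  ultimately show ?thesis unfolding spent_def
    by (simp add: card_Un_disjoint splitters_def disjoint_iff)
qed

lemma spent_le:
  assumes "finite G" "card G \<le> n" shows "spent n G i \<le> n"
proof -
  have "spent n G i \<le> card G"
    unfolding spent_def using assms(1) by (intro card_mono) auto
  then show ?thesis using assms(2) by linarith
qed

text \<open>The number of blind points decreases by at most \<open>2 ^ j - 1\<close> from one level to the next,
  where \<open>j\<close> is the number of generators charged to the upper of them. Each generator is
  charged only once, so the total loss down to level \<open>i\<close> is at most \<open>2 ^ s - 1\<close>, where \<open>s\<close> is
  the number of generators charged above \<open>i\<close>. As \<open>s \<le> n\<close>, some blind points always remain;
  here the width \<open>2 ^ n + 1\<close> is used.\<close>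

lemma card_blind:
  assumes G: "G \<subseteq> hcarrier (H n)" "finite G" "card G \<le> n"
  shows "2 ^ n + 2 \<le> card (blind n G i) + 2 ^ spent n G i"
proof (induction i)
  case 0
  then show ?case by (simp add: spent_def)
next
  case (Suc i)
  let ?s = "spent n G i" and ?j = "card (splitters n G i)"
  have "?s + ?j \<le> n" using spent_Suc[OF G(2)] spent_le[OF G(2,3)] by metis
  then have "(2::nat) ^ (?s + ?j) \<le> 2 ^ n" by (simp add: power_increasing)
  then have *: "2 ^ ?s + 2 ^ ?j \<le> (2::nat) ^ n + 1" using two_powers[of ?s ?j] by linarith
  \<comment> \<open>The generators charged to level \<open>i\<close> are too few to give every blind point a colour of its own.\<close>
  then have "2 ^ ?j < card (blind n G i)" using Suc by linarith
  then have "card (blind n G i) + 1 \<le> card (blind n G (Suc i)) + 2 ^ ?j"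
    using card_twins[OF G(1,2)] card_blind_Suc[of G i n] by fastforce
  then show ?case using Suc two_powers[of ?s ?j] unfolding spent_Suc[OF G(2)] by linarith
qed

lemma two_blind:
  assumes G: "G \<subseteq> hcarrier (H n)" "finite G" "card G \<le> n"
  shows "2 \<le> card (blind n G i)"
proof -
  have "(2::nat) ^ spent n G i \<le> 2 ^ n" using spent_le[OF G(2,3)] by (simp add: power_increasing)
  then show ?thesis using card_blind[OF G, of i] by linarith
qed

section \<open>Long stretches without variation collapse\<close>

definition quiet :: "nat \<Rightarrow> point set set \<Rightarrow> nat \<Rightarrow> bool" where
  "quiet n G i \<longleftrightarrow> (\<forall>l\<le>2 ^ n. \<forall>l'\<le>2 ^ n. color G i l = color G i l')"

lemma twins_quiet:
  assumes G: "G \<subseteq> hcarrier (H n)" "finite G" "card G \<le> n" and q: "quiet n G i"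
  shows "twins G i (blind n G i) = blind n G i"
proof -
  have "\<exists>l'\<in>blind n G i. l' \<noteq> l" for l
  proof (rule ccontr)
    assume "\<not> ?thesis"
    then have "blind n G i \<subseteq> {l}" by auto
    then have "card (blind n G i) \<le> 1" by (metis card_mono card.empty card_insert_disjoint
      finite.emptyI finite_insert One_nat_def empty_iff)
    then show False using two_blind[OF G, of i] by simp
  qed
  moreover have "color G i l' = color G i l" if "l \<in> blind n G i" "l' \<in> blind n G i" for l l'
    using q blind_le[OF that(1)] blind_le[OF that(2)] unfolding quiet_def by blast
  ultimately show ?thesis unfolding twins_def by blast
qed

text \<open>On a quiet level all blind points are twins, so an index that is not blind on the next level
  comes from one, larger by 1, that is not blind on this one. Since indices are bounded by
  \<open>2 ^ n\<close>, the points that are not blind die out.\<close>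

lemma blind_after_quiet:
  assumes G: "G \<subseteq> hcarrier (H n)" "finite G" "card G \<le> n"
    and "\<And>j. p \<le> j \<Longrightarrow> j < p + t \<Longrightarrow> quiet n G j" and "l \<le> 2 ^ n" "2 ^ n < l + t"
  shows "l \<in> blind n G (p + t)"
  using assms(4-)
proof (induction t arbitrary: l)
  case 0
  then show ?case by simp
next
  case (Suc t)
  have "l = 2 ^ n \<or> Suc l \<in> blind n G (p + t)"
    using Suc.IH[of "Suc l"] Suc.prems by fastforce
  moreover have "twins G (p + t) (blind n G (p + t)) = blind n G (p + t)"
    using Suc.prems by (intro twins_quiet[OF G]) auto
  ultimately show ?case using Suc.prems by auto
qed

text \<open>The \<open>2 ^ n + 1\<close> quiet levels from \<open>i - (2 ^ n + 2)\<close> to \<open>i - 2\<close> make all of level \<open>i - 1\<close>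
  blind, and as that level is quiet too, all its points are twins.\<close>

lemma glued_if_far:
  assumes G: "G \<subseteq> hcarrier (H n)" "finite G" "card G \<le> n"
    and i: "2 ^ n + 2 \<le> i"
    and far: "\<And>U. U \<in> G \<Longrightarrow> active n U \<Longrightarrow> depth U + (2 ^ n + 2) < i \<or> i + 2 < depth U"
  shows "glued n G i"
proof -
  have const: "color G a l = color G b l'"
    if ab: "i \<le> a + (2 ^ n + 2)" "a \<le> Suc i" "i \<le> b + (2 ^ n + 2)" "b \<le> Suc i"
      and l: "l \<le> 2 ^ n" "l' \<le> 2 ^ n" for a b l l'
  proof -
    have "Pt l a \<in> U \<longleftrightarrow> Pt l' b \<in> U" if U: "U \<in> G" for U
    proof (cases "active n U")
      case True
      from far[OF U True] show ?thesis
      proof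
        assume "depth U + (2 ^ n + 2) < i"
        then show ?thesis using depth_ge[OF True, of l a] depth_ge[OF True, of l' b] ab by linarith
      next
        assume "i + 2 < depth U"
        then show ?thesis
          using full_above_depth[OF True, of a l] full_above_depth[OF True, of b l'] ab l by simp
      qed
    next
      case False
      then have "U = {} \<or> U = P n" using active_or_trivial G U by blast
      then show ?thesis using l by auto
    qed
    then show ?thesis by (auto simp: color_def)
  qed
  have quiet: "quiet n G a" if "i \<le> a + (2 ^ n + 2)" "a \<le> Suc i" for a
    unfolding quiet_def using const that by blast
  have "{..2 ^ n} \<subseteq> twins G j (blind n G j)" if j: "i = Suc j" for j
  proof
    fix l assume "l \<in> {..(2::nat) ^ n}"
    then have "l \<in> blind n G ((j - (2 ^ n + 1)) + (2 ^ n + 1))"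
      using i j by (intro blind_after_quiet[OF G] quiet) auto
    then have "l \<in> blind n G j" using i j by simp
    then show "l \<in> twins G j (blind n G j)" using twins_quiet[OF G quiet] j by simp
  qed
  then show ?thesis unfolding glued_def using const by simp
qed

text \<open>Levels that are not glued lie among the first \<open>2 ^ n + 2\<close> ones or near the depth of a
  generator. Their number therefore does not depend on how deep the generators reach.\<close>

lemma card_base_levels:
  assumes G: "G \<subseteq> hcarrier (H n)" "finite G" "card G \<le> n"
  shows "finite (base_levels n G) \<and> card (base_levels n G) \<le> 2 ^ n + 3 + n * (2 ^ n + 5)"
proof -
  let ?N = "2 ^ n :: nat"
  let ?near = "\<lambda>U. {depth U - 2 .. depth U + (?N + 2)}"
  let ?X = "{..< ?N + 2} \<union> (\<Union>U\<in>G. ?near U)"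
  have sub: "{i. \<not> glued n G i} \<subseteq> ?X"
  proof
    fix i assume "i \<in> {i. \<not> glued n G i}"
    then have i: "\<not> glued n G i" by simp
    show "i \<in> ?X"
    proof (rule ccontr)
      assume "i \<notin> ?X"
      then have "?N + 2 \<le> i" and out: "\<And>U. U \<in> G \<Longrightarrow> i \<notin> ?near U" by auto
      moreover have "depth U + (?N + 2) < i \<or> i + 2 < depth U" if "U \<in> G" for U
        using out[OF that] by (simp only: atLeastAtMost_iff) linarith
      ultimately show False using glued_if_far[OF G, of i] i by blast
    qed
  qed
  have finX: "finite ?X" using G(2) by simp
  have "card (\<Union>U\<in>G. ?near U) \<le> (\<Sum>U\<in>G. card (?near U))" by (rule card_UN_le[OF G(2)])
  also have "\<dots> \<le> (\<Sum>U\<in>G. ?N + 5)" by (rule sum_mono) auto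
  also have "\<dots> \<le> n * (?N + 5)" using G(3) by simp
  finally have "card ?X \<le> ?N + 2 + n * (?N + 5)"
    using card_Un_le[of "{..< ?N + 2}" "\<Union>U\<in>G. ?near U"] by simp
  then have c: "card {i. \<not> glued n G i} \<le> ?N + 2 + n * (?N + 5)"
    using card_mono[OF finX sub] by linarith
  have f: "finite {i. \<not> glued n G i}" using finite_subset[OF sub finX] .
  then have "finite (base_levels n G)" by (simp add: base_levels_def)
  moreover have "card (base_levels n G) \<le> Suc (card {i. \<not> glued n G i})"
    using f by (simp add: base_levels_def card_insert_if card_image)
  ultimately show ?thesis using c by linarith
qed

definition size_bound :: "nat \<Rightarrow> nat" where
  "size_bound n = 2 ^ ((2 ^ n + 1) * (2 ^ n + 3 + n * (2 ^ n + 5)))"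

lemma card_saturated_sets:
  assumes G: "G \<subseteq> hcarrier (H n)" "finite G" "card G \<le> n"
  shows "finite (saturated_sets n G) \<and> card (saturated_sets n G) \<le> size_bound n"
proof -
  have b: "finite (base_levels n G)" "card (base_levels n G) \<le> 2 ^ n + 3 + n * (2 ^ n + 5)"
    using card_base_levels[OF G] by auto
  have fin: "finite (base_points n G)" using b by (simp add: base_points_def)
  have "card (base_points n G) \<le> card ({..2 ^ n :: nat} \<times> base_levels n G)"
    unfolding base_points_def using b by (intro card_image_le) simp
  also have "\<dots> = (2 ^ n + 1) * card (base_levels n G)" by (simp add: card_cartesian_product)
  also have "\<dots> \<le> (2 ^ n + 1) * (2 ^ n + 3 + n * (2 ^ n + 5))" using b(2) by (rule mult_le_mono2)
  finally have c: "card (base_points n G) \<le> (2 ^ n + 1) * (2 ^ n + 3 + n * (2 ^ n + 5))" .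
  have im: "(\<lambda>U. U \<inter> base_points n G) ` saturated_sets n G \<subseteq> Pow (base_points n G)" by auto
  have "finite (saturated_sets n G)"
    using inj_on_base_points im fin by (meson finite_Pow_iff inj_on_finite)
  moreover have "card (saturated_sets n G) \<le> card (Pow (base_points n G))"
    using inj_on_base_points im fin by (meson finite_Pow_iff card_inj_on_le)
  moreover have "card (Pow (base_points n G)) \<le> size_bound n"
    using c fin unfolding size_bound_def by (simp add: card_Pow power_increasing)
  ultimately show ?thesis by linarith
qed

text \<open>The bound does not mention \<open>G\<close>: mere finiteness for each \<open>G\<close> would not limit the number of
  isomorphism types.\<close>

lemma generated_bounded:
  assumes G: "G \<subseteq> hcarrier (H n)" "finite G" "card G \<le> n"
  shows "finite (generated (H n) G) \<and> card (generated (H n) G) \<le> size_bound n"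
proof -
  have "G \<subseteq> saturated_sets n G" using G saturated_generator by (auto simp: saturated_sets_def)
  then have "generated (H n) G \<subseteq> saturated_sets n G"
    using generated_least subalgebra_saturated_sets by blast
  then show ?thesis using card_saturated_sets[OF G]
    by (meson card_mono finite_subset order_trans)
qed

lemma k_generated_subalgebra_bounded:
  assumes "subalgebra B (H n)" "k_generated (restrict_algebra (H n) B) n"
  shows "finite B \<and> card B \<le> size_bound n"
proof -
  obtain G where G: "G \<subseteq> B" "finite G" "card G = n" "generated (restrict_algebra (H n) B) G = B"
    using assms(2) by (auto simp: k_generated_def restrict_algebra_def)
  then have "generated (H n) G = B" using generated_restrict[OF assms(1) G(1)] by simp
  then show ?thesis using generated_bounded[of G n] G assms(1) by (auto simp: subalgebra_def)
qed

section \<open>The main result\<close>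

theorem proposition18:
  fixes k :: nat
  shows "heyting_algebra (H k) \<and>
         k_generated (H k) (k + 1) \<and>
         (\<forall>B. subalgebra B (H k) \<and> k_generated (restrict_algebra (H k) B) k \<longrightarrow> finite B) \<and>
         finite (k_generated_subalgebras (H k) k // subalgebra_iso_rel (H k)) \<and>
         strictly_k_generated (H k) (k + 1)"
proof (intro conjI)
  show "heyting_algebra (H k)" by (rule heyting_algebra_H)
  show "k_generated (H k) (k + 1)" by (rule k_generated_H)
  show "\<forall>B. subalgebra B (H k) \<and> k_generated (restrict_algebra (H k) B) k \<longrightarrow> finite B"
    using k_generated_subalgebra_bounded by blast
  show "finite (k_generated_subalgebras (H k) k // subalgebra_iso_rel (H k))"
    by (rule finite_iso_types_if_bounded[where m = "size_bound k"])
      (use k_generated_subalgebra_bounded in \<open>auto simp: k_generated_subalgebras_def\<close>)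
  show "strictly_k_generated (H k) (k + 1)"
    unfolding strictly_k_generated_def strongly_not_k_generated_def
    using infinite_carrier_H k_generated_H generated_bounded by simp
qed

end
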